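(* Let $X$ be an infinite paracompact Hausdorff space and let $\mathfrak U$ be the universal uniformity on $X$. Then, for $\square\in\{1,\mathrm{fin}\}$, \[\mathrm{I} \underset{\mathrm{pre}}{\uparrow} \mathsf{G}_\square(\mathcal{C}_{\mathfrak U}(X), \mathcal O_X) \iff \mathrm{I} \uparrow \mathsf{G}_\square(\mathcal{C}_{\mathfrak U}(X), \mathcal O_X).\]
   Context: The universal (fine) uniformity on $X$ is the finest uniformity on $X$ compatible with its topology. For a uniformity $\mathcal E$ on $X$, $\mathcal C_{\mathcal E}(X)$ is the collection of all open uniform covers: families $\mathscr U$ of open sets for which there is $E\in\mathcal E$ such that every set $E[x]=\{y:(x,y)\in E\}$, $x \in X$, is contained in some member of $\mathscr U$. $\mathcal O_X$ is the collection of all non-trivial open covers of $X$, that is, open covers $\mathscr U$ with $X\notin\mathscr U$. Selection games. For collections $\mathcal A,\mathcal B$ of sets, in $\mathsf G_1(\mathcal A,\mathcal B)$ in round $n\in\omega$ player One plays $A_n\in\mathcal A$ and player Two responds with $x_n\in A_n$; Two wins iff $\{x_n:n\in\omega\}\in\mathcal B$. In $\mathsf G_{\mathrm{fin}}(\mathcal A,\mathcal B)$ Two instead plays a finite $\mathcal F_n\subseteq A_n$ and wins iff $\bigcup_n\mathcal F_n\in\mathcal B$. Otherwise One wins. A strategy for One is a function from finite sequences of Two's moves to $\mathcal A$; it is predetermined if it depends only on the round number; it is winning if One wins every play following it. $\mathrm I\uparrow\mathcal G$ (resp. $\mathrm I\underset{\mathrm{pre}}{\uparrow}\mathcal G$)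 means One has a winning strategy (resp. a winning predetermined strategy) in $\mathcal G$. *)

theory Defs
  imports "HOL-Analysis.Analysis"
begin

section \<open>Paracompactness and open covers\<close>

definition open_cover :: "'a topology \<Rightarrow> 'a set set \<Rightarrow> bool" where
  "open_cover X \<U> \<longleftrightarrow> (\<forall>U\<in>\<U>. openin X U) \<and> \<Union>\<U> = topspace X"

definition paracompact_space :: "'a topology \<Rightarrow> bool" where
  "paracompact_space X \<longleftrightarrow>
     (\<forall>\<U>. open_cover X \<U> \<longrightarrow>
        (\<exists>\<V>. open_cover X \<V> \<and> (\<forall>V\<in>\<V>. \<exists>U\<in>\<U>. V \<subseteq> U) \<and> locally_finite_in X \<V>))"

definition nontrivial_open_covers :: "'a topology \<Rightarrow> 'a set set set" where
  "nontrivial_open_covers X = {\<U>. open_cover X \<U> \<and> topspace X \<notin> \<U>}"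

section \<open>Uniformities\<close>

text \<open>The class of uniform spaces in the library fixes one uniformity per type. Comparing
  several uniformities on one space needs uniformities as objects; here they are
  sets of entourages on a carrier set.\<close>

definition is_uniformity :: "'a set \<Rightarrow> ('a \<times> 'a) set set \<Rightarrow> bool" where
  "is_uniformity S \<E> \<longleftrightarrow>
     \<E> \<noteq> {} \<and>
     (\<forall>E\<in>\<E>. Id_on S \<subseteq> E \<and> E \<subseteq> S \<times> S) \<and>
     (\<forall>E\<in>\<E>. \<forall>F. E \<subseteq> F \<and> F \<subseteq> S \<times> S \<longrightarrow> F \<in> \<E>) \<and>
     (\<forall>E\<in>\<E>. \<forall>F\<in>\<E>. E \<inter> F \<in> \<E>) \<and>
     (\<forall>E\<in>\<E>. E\<inverse> \<in> \<E>) \<and>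
     (\<forall>E\<in>\<E>. \<exists>D\<in>\<E>. D O D \<subseteq> E)"

definition compatible_uniformity :: "'a topology \<Rightarrow> ('a \<times> 'a) set set \<Rightarrow> bool" where
  "compatible_uniformity X \<E> \<longleftrightarrow>
     is_uniformity (topspace X) \<E> \<and>
     (\<forall>U. openin X U \<longleftrightarrow> U \<subseteq> topspace X \<and> (\<forall>x\<in>U. \<exists>E\<in>\<E>. E `` {x} \<subseteq> U))"

text \<open>Finer means having more entourages, so the finest compatible uniformity is the greatest
  one under inclusion; it is unique if it exists.\<close>

definition universal_uniformity :: "'a topology \<Rightarrow> ('a \<times> 'a) set set \<Rightarrow> bool" where
  "universal_uniformity X \<UU> \<longleftrightarrow>
     compatible_uniformity X \<UU> \<and> (\<forall>\<E>. compatible_uniformity X \<E> \<longrightarrow> \<E> \<subseteq> \<UU>)"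

text \<open>The first collection contains the trivial cover consisting of the whole space only. If One
  may play it, Two can never produce a nontrivial cover against it; the second collection excludes
  it by the convention that covers are nontrivial. The covering property need not be required, as
  entourages contain the diagonal.\<close>

definition uniform_open_covers ::
    "'a topology \<Rightarrow> ('a \<times> 'a) set set \<Rightarrow> 'a set set set" where
  "uniform_open_covers X \<E> =
     {\<U>. (\<forall>U\<in>\<U>. openin X U) \<and> (\<exists>E\<in>\<E>. \<forall>x\<in>topspace X. \<exists>U\<in>\<U>. E `` {x} \<subseteq> U)}"

definition nontrivial_uniform_open_covers ::
    "'a topology \<Rightarrow> ('a \<times> 'a) set set \<Rightarrow> 'a set set set" where
  "nontrivial_uniform_open_covers X \<E> =
     {\<U> \<in> uniform_open_covers X \<E>. topspace X \<notin> \<U>}"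

section \<open>Selection games\<close>

text \<open>A game of length \<open>\<omega>\<close>: the moves available to One, the responses available to Two
  in the same round (depending on One's move), and the sequences of moves of Two that win
  for Two.\<close>

record ('o, 't) omega_game =
  one_moves :: "'o set"
  two_moves :: "'o \<Rightarrow> 't set"
  two_wins :: "(nat \<Rightarrow> 't) set"

definition G1 :: "'b set set \<Rightarrow> 'b set set \<Rightarrow> ('b set, 'b) omega_game" where
  "G1 \<A> \<B> = \<lparr>one_moves = \<A>, two_moves = (\<lambda>A. A), two_wins = {x. range x \<in> \<B>}\<rparr>"

definition Gfin :: "'b set set \<Rightarrow> 'b set set \<Rightarrow> ('b set, 'b set) omega_game" where
  "Gfin \<A> \<B> = \<lparr>one_moves = \<A>, two_moves = (\<lambda>A. {F. finite F \<and> F \<subseteq> A}),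
     two_wins = {F. (\<Union>n. F n) \<in> \<B>}\<rparr>"

definition strategy_One :: "('o, 't) omega_game \<Rightarrow> ('t list \<Rightarrow> 'o) \<Rightarrow> bool" where
  "strategy_One \<G> \<sigma> \<longleftrightarrow> (\<forall>s. \<sigma> s \<in> one_moves \<G>)"

definition predetermined :: "('t list \<Rightarrow> 'o) \<Rightarrow> bool" where
  "predetermined \<sigma> \<longleftrightarrow> (\<forall>s t. length s = length t \<longrightarrow> \<sigma> s = \<sigma> t)"

text \<open>A play following a strategy of One is determined by the moves of Two; in round \<open>n\<close>
  the strategy sees the list \<open>map x [0..<n]\<close> of the earlier moves of Two.\<close>

definition winning_One :: "('o, 't) omega_game \<Rightarrow> ('t list \<Rightarrow> 'o) \<Rightarrow> bool" where
  "winning_One \<G> \<sigma> \<longleftrightarrow>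
     (\<forall>x. (\<forall>n. x n \<in> two_moves \<G> (\<sigma> (map x [0..<n]))) \<longrightarrow> x \<notin> two_wins \<G>)"

definition One_wins :: "('o, 't) omega_game \<Rightarrow> bool" where
  "One_wins \<G> \<longleftrightarrow> (\<exists>\<sigma>. strategy_One \<G> \<sigma> \<and> winning_One \<G> \<sigma>)"

definition One_wins_pre :: "('o, 't) omega_game \<Rightarrow> bool" where
  "One_wins_pre \<G> \<longleftrightarrow> (\<exists>\<sigma>. strategy_One \<G> \<sigma> \<and> predetermined \<sigma> \<and> winning_One \<G> \<sigma>)"

end

theory Submission
  imports Defs
begin

text \<open>In a paracompact Hausdorff space every open cover has an open point-star refinement, so the
  neighbourhoods of the diagonal that contain some \<open>\<Union>V\<in>\<V>. V \<times> V\<close> form a compatible uniformity, and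
  every open cover is uniform for the universal one. The claim thus reduces to the theorems of
  Hurewicz (Menger game) and Pawlikowski (Rothberger game). If One has no predetermined winning
  strategy, then \<open>X\<close> is a Menger space, so every move of One may be enumerated and his strategy
  becomes a tree \<open>U\<close> of covers indexed by finite sequences of numbers. The Menger property yields a
  sequence \<open>a\<close> such that every point lies, for infinitely many \<open>n\<close>, in \<open>\<Union>k<a (n+1). U s k\<close>
  for all \<open>s\<close> with length and entries at most \<open>a n\<close>. In the Menger game Two wins by playing the
  first \<open>a (n+1)\<close> sets in round \<open>n\<close>. In the Rothberger game, the Rothberger property selects
  for each \<open>n\<close> one reply to each of these finitely many \<open>s\<close> at once.\<close>

section \<open>The universal uniformity of a paracompact Hausdorff space\<close>

lemma open_cover_member:
  assumes "open_cover X \<U>" "x \<in> topspace X"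
  obtains U where "U \<in> \<U>" "x \<in> U" "openin X U"
proof -
  have "x \<in> \<Union>\<U>" using assms unfolding open_cover_def by simp
  then obtain U where "U \<in> \<U>" "x \<in> U" by (rule UnionE)
  then show ?thesis using that assms(1) unfolding open_cover_def by simp
qed

lemma paracompact_spaceE:
  assumes "paracompact_space X" "open_cover X \<U>"
  obtains \<V> where "open_cover X \<V>" "\<And>V. V \<in> \<V> \<Longrightarrow> \<exists>U\<in>\<U>. V \<subseteq> U" "locally_finite_in X \<V>"
  using assms(1)[unfolded paracompact_space_def, rule_format, OF assms(2)] by metis

text \<open>Cover the space by the complement of \<open>C\<close> and the open sets whose closure
  misses \<open>a\<close>. Refining sets that meet \<open>C\<close> have closures missing
  \<open>a\<close>, and local finiteness passes this on to their union.\<close>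

lemma paracompact_Hausdorff_imp_regular_space:
  assumes "paracompact_space X" "Hausdorff_space X"
  shows "regular_space X"
  unfolding regular_space_def
proof (intro allI impI)
  fix C a assume "closedin X C \<and> a \<in> topspace X - C"
  then have C: "closedin X C" and a: "a \<in> topspace X" "a \<notin> C" by auto
  define \<U> where "\<U> = insert (topspace X - C) {V. openin X V \<and> a \<notin> X closure_of V}"
  have "\<exists>V. openin X V \<and> y \<in> V \<and> a \<notin> X closure_of V" if "y \<in> C" for y
  proof -
    have "y \<in> topspace X" "y \<noteq> a" using that C a closedin_subset by blast+
    then obtain N V where "openin X N" "openin X V" "a \<in> N" "y \<in> V" "disjnt N V"
      using assms(2) a unfolding Hausdorff_space_def by metis
    then have "N \<inter> X closure_of V = {}"
      by (simp add: openin_Int_closure_of_eq_empty disjnt_def)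
    then show ?thesis using \<open>openin X V\<close> \<open>a \<in> N\<close> \<open>y \<in> V\<close> by blast
  qed
  moreover have "openin X (topspace X - C)" using C by (simp add: closedin_def)
  ultimately have "open_cover X \<U>"
    unfolding open_cover_def \<U>_def by (auto dest: openin_subset)
  then obtain \<W> where \<W>: "open_cover X \<W>" "\<And>W. W \<in> \<W> \<Longrightarrow> \<exists>U\<in>\<U>. W \<subseteq> U" "locally_finite_in X \<W>"
    using paracompact_spaceE[OF assms(1)] by metis
  define \<G> where "\<G> = {W\<in>\<W>. W \<inter> C \<noteq> {}}"
  have lf: "locally_finite_in X \<G>"
    by (rule locally_finite_in_subset[OF \<W>(3)]) (auto simp: \<G>_def)
  have "a \<notin> X closure_of W" if "W \<in> \<G>" for W
  proof -
    have W: "W \<in> \<W>" "W \<inter> C \<noteq> {}" using that unfolding \<G>_def by simp_all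
    obtain V where V: "V \<in> \<U>" "W \<subseteq> V" using \<W>(2)[OF W(1)] by metis
    then have "a \<notin> X closure_of V" using W(2) unfolding \<U>_def by auto
    then show ?thesis using closure_of_mono[OF V(2), of X] by auto
  qed
  then have "a \<notin> X closure_of \<Union>\<G>"
    by (simp add: closure_of_locally_finite_Union[OF lf])
  moreover have "openin X (\<Union>\<G>)"
    using \<W>(1) unfolding open_cover_def \<G>_def by (intro openin_Union) simp
  moreover have "C \<subseteq> \<Union>\<G>"
    using \<W>(1) closedin_subset[OF C] unfolding open_cover_def \<G>_def by blast
  moreover from calculation have "\<Union>\<G> \<subseteq> X closure_of \<Union>\<G>"
    by (intro closure_of_subset openin_subset)
  ultimately show "\<exists>U V. openin X U \<and> openin X V \<and> a \<in> U \<and> C \<subseteq> V \<and> disjnt U V"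
    using a by (intro exI[of _ "topspace X - X closure_of \<Union>\<G>"] exI[of _ "\<Union>\<G>"])
      (auto simp: disjnt_def)
qed

text \<open>By regularity the sets whose closure fits into a member of \<open>\<U>\<close> form a
  cover; a locally finite refinement of it is then closed up.\<close>

lemma paracompact_closed_refinement:
  assumes "paracompact_space X" "Hausdorff_space X" "open_cover X \<U>"
  obtains \<C> where "\<And>C. C \<in> \<C> \<Longrightarrow> closedin X C" "\<And>C. C \<in> \<C> \<Longrightarrow> \<exists>U\<in>\<U>. C \<subseteq> U"
    "\<Union>\<C> = topspace X" "locally_finite_in X \<C>"
proof -
  define \<V> where "\<V> = {V. openin X V \<and> (\<exists>U\<in>\<U>. X closure_of V \<subseteq> U)}"
  have "\<exists>V\<in>\<V>. x \<in> V" if x: "x \<in> topspace X" for x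
  proof -
    obtain U where U: "U \<in> \<U>" "x \<in> U" "openin X U"
      using open_cover_member[OF assms(3) x] by metis
    then have "closedin X (topspace X - U)" "x \<in> topspace X - (topspace X - U)"
      using x by auto
    then obtain N V where N: "openin X N" "openin X V" "x \<in> N" "topspace X - U \<subseteq> V" "disjnt N V"
      using paracompact_Hausdorff_imp_regular_space[OF assms(1,2)]
      unfolding regular_space_def by metis
    have "V \<inter> X closure_of N = {}"
      using N by (auto simp: openin_Int_closure_of_eq_empty disjnt_def)
    then have "X closure_of N \<subseteq> U"
      using N(4) closure_of_subset_topspace by fastforce
    then show ?thesis using N(1,3) U(1) unfolding \<V>_def by auto
  qed
  then have "open_cover X \<V>"
    unfolding open_cover_def \<V>_def by (auto dest: openin_subset)
  then obtain \<W> where \<W>: "open_cover X \<W>" "\<And>W. W \<in> \<W> \<Longrightarrow> \<exists>V\<in>\<V>. W \<subseteq> V" "locally_finite_in X \<W>"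
    using paracompact_spaceE[OF assms(1)] by metis
  show ?thesis
  proof
    show "locally_finite_in X ((\<lambda>S. X closure_of S) ` \<W>)"
      by (rule locally_finite_in_closure[OF \<W>(3)])
    show "\<exists>U\<in>\<U>. C \<subseteq> U" if C: "C \<in> (\<lambda>S. X closure_of S) ` \<W>" for C
    proof -
      obtain W where W: "W \<in> \<W>" "C = X closure_of W" using C by auto
      obtain V where V: "V \<in> \<V>" "W \<subseteq> V" using \<W>(2)[OF W(1)] by metis
      obtain U where U: "U \<in> \<U>" "X closure_of V \<subseteq> U" using V(1) unfolding \<V>_def by auto
      have "C \<subseteq> U" using closure_of_mono[OF V(2), of X] U(2) W(2) by simp
      then show ?thesis using U(1) by blast
    qed
    show "\<Union>((\<lambda>S. X closure_of S) ` \<W>) = topspace X"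
      using closure_of_locally_finite_Union[OF \<W>(3)] \<W>(1) unfolding open_cover_def by simp
  qed auto
qed

lemma paracompact_point_star_refinement:
  assumes "paracompact_space X" "Hausdorff_space X" "open_cover X \<U>"
  obtains \<V> where "open_cover X \<V>"
    "\<And>x. x \<in> topspace X \<Longrightarrow> \<exists>U\<in>\<U>. \<forall>V\<in>\<V>. x \<in> V \<longrightarrow> V \<subseteq> U"
proof -
  obtain \<C> where \<C>: "\<And>C. C \<in> \<C> \<Longrightarrow> closedin X C" "\<And>C. C \<in> \<C> \<Longrightarrow> \<exists>U\<in>\<U>. C \<subseteq> U"
    "\<Union>\<C> = topspace X" "locally_finite_in X \<C>"
    using paracompact_closed_refinement[OF assms] by metis
  obtain u where u: "\<And>C. C \<in> \<C> \<Longrightarrow> u C \<in> \<U> \<and> C \<subseteq> u C" using \<C>(2) by metis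
  \<comment> \<open>If \<open>y \<in> v x\<close>, every \<open>C\<close> through \<open>y\<close>
    contains \<open>x\<close>, since otherwise it was removed; hence
    \<open>v x \<subseteq> u C\<close>, where \<open>C\<close> depends on \<open>y\<close>
    alone.\<close>
  define v where
    "v x = (topspace X \<inter> \<Inter>(u ` {C\<in>\<C>. x \<in> C})) - \<Union>{C\<in>\<C>. x \<notin> C}" for x
  have "openin X (v x)" if x: "x \<in> topspace X" for x
  proof -
    obtain N where N: "openin X N" "x \<in> N" "finite {C\<in>\<C>. C \<inter> N \<noteq> {}}"
      using \<C>(4)[unfolded locally_finite_in_def, THEN conjunct2, rule_format, OF x] by metis
    have "finite {C\<in>\<C>. x \<in> C}"
      by (rule finite_subset[OF _ N(3)]) (use N(2) in blast)
    then have "openin X (topspace X \<inter> \<Inter>(u ` {C\<in>\<C>. x \<in> C}))"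
      using u assms(3) unfolding open_cover_def
      by (intro openin_Int_Inter) auto
    moreover have "closedin X (\<Union>{C\<in>\<C>. x \<notin> C})"
      by (rule closedin_locally_finite_Union)
        (use \<C> in \<open>auto intro: locally_finite_in_subset\<close>)
    ultimately show ?thesis unfolding v_def by (rule openin_diff)
  qed
  moreover have "x \<in> v x" if "x \<in> topspace X" for x
    using that u unfolding v_def by blast
  moreover have "v x \<subseteq> topspace X" for x
    unfolding v_def by blast
  ultimately have "open_cover X (v ` topspace X)"
    unfolding open_cover_def by blast
  moreover have "\<exists>U\<in>\<U>. \<forall>V\<in>v ` topspace X. y \<in> V \<longrightarrow> V \<subseteq> U" if y: "y \<in> topspace X" for y
  proof -
    obtain C where C: "C \<in> \<C>" "y \<in> C" using y unfolding \<C>(3)[symmetric] by auto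
    have "v x \<subseteq> u C" if "y \<in> v x" for x
      using that C unfolding v_def by auto
    then show ?thesis using u[OF C(1)] by (intro bexI[of _ "u C"]) auto
  qed
  ultimately show ?thesis by (rule that)
qed

section \<open>The uniformity of neighbourhoods of the diagonal\<close>

text \<open>Every neighbourhood of \<open>(x, x)\<close> contains \<open>V \<times> V\<close> for an
  open \<open>V\<close> around \<open>x\<close>, so these are all the neighbourhoods of the
  diagonal.\<close>

definition cover_uniformity :: "'a topology \<Rightarrow> ('a \<times> 'a) set set" where
  "cover_uniformity X =
     {E. E \<subseteq> topspace X \<times> topspace X \<and> (\<exists>\<V>. open_cover X \<V> \<and> (\<Union>V\<in>\<V>. V \<times> V) \<subseteq> E)}"

lemma cover_uniformityI:
  assumes "E \<subseteq> topspace X \<times> topspace X" "open_cover X \<V>" "\<And>V. V \<in> \<V> \<Longrightarrow> V \<times> V \<subseteq> E"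
  shows "E \<in> cover_uniformity X"
  unfolding cover_uniformity_def using assms by (auto intro!: exI[of _ \<V>])

lemma cover_uniformityE:
  assumes "E \<in> cover_uniformity X"
  obtains \<V> where "E \<subseteq> topspace X \<times> topspace X" "open_cover X \<V>"
    "\<And>V. V \<in> \<V> \<Longrightarrow> V \<times> V \<subseteq> E"
proof -
  obtain \<V> where "E \<subseteq> topspace X \<times> topspace X" "open_cover X \<V>" "(\<Union>V\<in>\<V>. V \<times> V) \<subseteq> E"
    using assms unfolding cover_uniformity_def by auto
  then show ?thesis using that[of \<V>] by auto
qed

lemma open_cover_common_refinement:
  assumes "open_cover X \<U>" "open_cover X \<V>"
  shows "open_cover X {U \<inter> V |U V. U \<in> \<U> \<and> V \<in> \<V>}"
proof -
  have "\<Union>{U \<inter> V |U V. U \<in> \<U> \<and> V \<in> \<V>} = \<Union>\<U> \<inter> \<Union>\<V>" by blast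
  then show ?thesis using assms unfolding open_cover_def by auto
qed

lemma is_uniformity_cover_uniformity:
  assumes "paracompact_space X" "Hausdorff_space X"
  shows "is_uniformity (topspace X) (cover_uniformity X)"
  unfolding is_uniformity_def
proof (intro conjI ballI allI impI)
  let ?S = "topspace X"
  have "?S \<times> ?S \<in> cover_uniformity X"
    by (rule cover_uniformityI[of _ _ "{?S}"]) (auto simp: open_cover_def)
  then show "cover_uniformity X \<noteq> {}" by blast
next
  fix E assume E: "E \<in> cover_uniformity X"
  obtain \<U> where \<U>: "E \<subseteq> topspace X \<times> topspace X" "open_cover X \<U>"
    "\<And>V. V \<in> \<U> \<Longrightarrow> V \<times> V \<subseteq> E"
    using cover_uniformityE[OF E] by metis
  show "E \<subseteq> topspace X \<times> topspace X" by (rule \<U>(1))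
  show "Id_on (topspace X) \<subseteq> E"
  proof
    fix p assume "p \<in> Id_on (topspace X)"
    then obtain x where x: "x \<in> topspace X" "p = (x, x)" by (auto simp: Id_on_def)
    obtain U where "U \<in> \<U>" "x \<in> U" by (rule open_cover_member[OF \<U>(2) x(1)])
    then show "p \<in> E" using \<U>(3)[of U] x(2) by auto
  qed
  show "F \<in> cover_uniformity X" if "E \<subseteq> F \<and> F \<subseteq> topspace X \<times> topspace X" for F
    using that \<U>(2,3) by (intro cover_uniformityI[of _ _ \<U>]) auto
  show "E\<inverse> \<in> cover_uniformity X"
    using \<U> by (intro cover_uniformityI[of _ _ \<U>]) auto
  show "E \<inter> F \<in> cover_uniformity X" if F: "F \<in> cover_uniformity X" for F
  proof -
    obtain \<V> where \<V>: "F \<subseteq> topspace X \<times> topspace X" "open_cover X \<V>"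
      "\<And>V. V \<in> \<V> \<Longrightarrow> V \<times> V \<subseteq> F"
      using cover_uniformityE[OF F] by metis
    show ?thesis
    proof (rule cover_uniformityI)
      show "E \<inter> F \<subseteq> topspace X \<times> topspace X" using \<U>(1) by auto
      show "open_cover X {U \<inter> V |U V. U \<in> \<U> \<and> V \<in> \<V>}"
        by (rule open_cover_common_refinement[OF \<U>(2) \<V>(2)])
      fix W assume "W \<in> {U \<inter> V |U V. U \<in> \<U> \<and> V \<in> \<V>}"
      then obtain U V where "W = U \<inter> V" "U \<in> \<U>" "V \<in> \<V>" by auto
      then show "W \<times> W \<subseteq> E \<inter> F" using \<U>(3)[of U] \<V>(3)[of V] by auto
    qed
  qed
  obtain \<V> where \<V>: "open_cover X \<V>"
    "\<And>x. x \<in> topspace X \<Longrightarrow> \<exists>U\<in>\<U>. \<forall>V\<in>\<V>. x \<in> V \<longrightarrow> V \<subseteq> U"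
    using paracompact_point_star_refinement[OF assms \<U>(2)] by metis
  have sub: "V \<subseteq> topspace X" if "V \<in> \<V>" for V
    using \<V>(1) that unfolding open_cover_def by auto
  have "(\<Union>V\<in>\<V>. V \<times> V) \<in> cover_uniformity X"
    using \<V>(1) sub by (intro cover_uniformityI[of _ _ \<V>]) fast+
  \<comment> \<open>Two chained pairs share the middle point \<open>y\<close>, whose star lies in
    one member of \<open>\<U>\<close>.\<close>
  moreover have "(\<Union>V\<in>\<V>. V \<times> V) O (\<Union>V\<in>\<V>. V \<times> V) \<subseteq> E"
  proof clarsimp
    fix x y z V W assume *: "V \<in> \<V>" "W \<in> \<V>" "x \<in> V" "y \<in> V" "y \<in> W" "z \<in> W"
    then have "y \<in> topspace X" using sub by auto
    then obtain U where "U \<in> \<U>" "V \<subseteq> U" "W \<subseteq> U" using \<V>(2)[of y] * by auto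
    then show "(x, z) \<in> E" using * \<U>(3)[of U] by auto
  qed
  ultimately show "\<exists>D\<in>cover_uniformity X. D O D \<subseteq> E" by (rule rev_bexI)
qed

lemma compatible_cover_uniformity:
  assumes "paracompact_space X" "Hausdorff_space X"
  shows "compatible_uniformity X (cover_uniformity X)"
  unfolding compatible_uniformity_def
proof (intro conjI allI iffI ballI)
  show "is_uniformity (topspace X) (cover_uniformity X)"
    by (rule is_uniformity_cover_uniformity[OF assms])
next
  fix U assume U: "openin X U"
  show sub: "U \<subseteq> topspace X" by (rule openin_subset[OF U])
  fix x assume x: "x \<in> U"
  let ?V = "topspace X - {x}"
  have "closedin X {x}"
    using Hausdorff_imp_t1_space[OF assms(2)] x sub unfolding t1_space_closedin_singleton by auto
  then have "openin X ?V" by (simp add: closedin_def)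
  then have "open_cover X {U, ?V}"
    using U x sub unfolding open_cover_def by auto
  \<comment> \<open>Of the two covering sets only \<open>U\<close> contains \<open>x\<close>, so the
    section of this entourage at \<open>x\<close> is \<open>U\<close>.\<close>
  then have "U \<times> U \<union> ?V \<times> ?V \<in> cover_uniformity X"
    by (rule cover_uniformityI[rotated]) (use sub in auto)
  then show "\<exists>E\<in>cover_uniformity X. E `` {x} \<subseteq> U" by (rule rev_bexI) auto
next
  fix U assume U: "U \<subseteq> topspace X \<and> (\<forall>x\<in>U. \<exists>E\<in>cover_uniformity X. E `` {x} \<subseteq> U)"
  show "openin X U"
  proof (subst openin_subopen, intro ballI)
    fix x assume x: "x \<in> U"
    then obtain E where E: "E \<in> cover_uniformity X" "E `` {x} \<subseteq> U" using U by auto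
    obtain \<V> where \<V>: "open_cover X \<V>" "\<And>V. V \<in> \<V> \<Longrightarrow> V \<times> V \<subseteq> E"
      using cover_uniformityE[OF E(1)] by metis
    obtain V where V: "V \<in> \<V>" "x \<in> V" "openin X V"
      using open_cover_member[OF \<V>(1)] x U by blast
    then show "\<exists>T. openin X T \<and> x \<in> T \<and> T \<subseteq> U"
      using E(2) \<V>(2)[OF V(1)] by blast
  qed
qed

text \<open>Uniform families cover because entourages contain the diagonal. Conversely, a point-star
  refinement gives an entourage whose sections are stars, and the universal uniformity contains it
  as the greatest compatible one.\<close>

lemma uniform_open_covers_universal:
  assumes "paracompact_space X" "Hausdorff_space X" "universal_uniformity X \<UU>"
  shows "uniform_open_covers X \<UU> = {\<U>. open_cover X \<U>}"
proof (intro equalityI subsetI CollectI)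
  fix \<U> assume "\<U> \<in> uniform_open_covers X \<UU>"
  then obtain E where E: "\<forall>U\<in>\<U>. openin X U" "E \<in> \<UU>" "\<forall>x\<in>topspace X. \<exists>U\<in>\<U>. E `` {x} \<subseteq> U"
    unfolding uniform_open_covers_def by auto
  have "Id_on (topspace X) \<subseteq> E"
    using assms(3) E(2)
    unfolding universal_uniformity_def compatible_uniformity_def is_uniformity_def by simp
  then have "topspace X \<subseteq> \<Union>\<U>" using E(3) by blast
  then show "open_cover X \<U>" using E(1) unfolding open_cover_def by (auto dest: openin_subset)
next
  fix \<U> assume "\<U> \<in> {\<U>. open_cover X \<U>}"
  then have \<U>: "open_cover X \<U>" by simp
  obtain \<V> where \<V>: "open_cover X \<V>"
    "\<And>x. x \<in> topspace X \<Longrightarrow> \<exists>U\<in>\<U>. \<forall>V\<in>\<V>. x \<in> V \<longrightarrow> V \<subseteq> U"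
    using paracompact_point_star_refinement[OF assms(1,2) \<U>] by metis
  let ?E = "\<Union>V\<in>\<V>. V \<times> V"
  have "V \<subseteq> topspace X" if "V \<in> \<V>" for V
    using \<V>(1) that unfolding open_cover_def by auto
  then have "?E \<in> cover_uniformity X"
    using \<V>(1) by (intro cover_uniformityI[of _ _ \<V>]) fast+
  then have "?E \<in> \<UU>"
    using assms(3) compatible_cover_uniformity[OF assms(1,2)]
    unfolding universal_uniformity_def by auto
  moreover have "\<forall>x\<in>topspace X. \<exists>U\<in>\<U>. ?E `` {x} \<subseteq> U"
  proof
    fix x assume "x \<in> topspace X"
    then obtain U where "U \<in> \<U>" "\<And>V. V \<in> \<V> \<Longrightarrow> x \<in> V \<Longrightarrow> V \<subseteq> U" using \<V>(2) by metis
    then show "\<exists>U\<in>\<U>. ?E `` {x} \<subseteq> U" by (intro bexI[of _ U]) auto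
  qed
  ultimately show "\<U> \<in> uniform_open_covers X \<UU>"
    using \<U> unfolding uniform_open_covers_def open_cover_def by auto
qed

lemma nontrivial_uniform_open_covers_universal:
  assumes "paracompact_space X" "Hausdorff_space X" "universal_uniformity X \<UU>"
  shows "nontrivial_uniform_open_covers X \<UU> = nontrivial_open_covers X"
  unfolding nontrivial_uniform_open_covers_def nontrivial_open_covers_def
    uniform_open_covers_universal[OF assms] by simp

section \<open>Selection principles\<close>

definition menger_space :: "'a topology \<Rightarrow> bool" where
  "menger_space X \<longleftrightarrow>
     (\<forall>A::nat \<Rightarrow> 'a set set. (\<forall>n. open_cover X (A n)) \<longrightarrow>
        (\<exists>F. (\<forall>n. finite (F n) \<and> F n \<subseteq> A n) \<and> \<Union>(\<Union>n. F n) = topspace X))"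

definition rothberger_space :: "'a topology \<Rightarrow> bool" where
  "rothberger_space X \<longleftrightarrow>
     (\<forall>A::nat \<Rightarrow> 'a set set. (\<forall>n. open_cover X (A n)) \<longrightarrow>
        (\<exists>x. (\<forall>n. x n \<in> A n) \<and> \<Union>(range x) = topspace X))"

lemma menger_spaceE:
  fixes A :: "nat \<Rightarrow> 'a set set"
  assumes "menger_space X" "\<And>n. open_cover X (A n)"
  obtains F where "\<And>n. finite (F n)" "\<And>n. F n \<subseteq> A n" "\<Union>(\<Union>n. F n) = topspace X"
  using assms(1)[unfolded menger_space_def, rule_format, of A] assms(2) by auto

lemma rothberger_spaceE:
  fixes A :: "nat \<Rightarrow> 'a set set"
  assumes "rothberger_space X" "\<And>n. open_cover X (A n)"
  obtains x where "\<And>n. x n \<in> A n" "\<Union>(range x) = topspace X"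
  using assms(1)[unfolded rothberger_space_def, rule_format, of A] assms(2) by auto

lemma rothberger_imp_menger:
  assumes "rothberger_space X"
  shows "menger_space X"
  unfolding menger_space_def
proof (intro allI impI)
  fix A :: "nat \<Rightarrow> 'a set set" assume "\<forall>n. open_cover X (A n)"
  then obtain x where x: "\<And>n. x n \<in> A n" "\<Union>(range x) = topspace X"
    using rothberger_spaceE[OF assms] by metis
  have "(\<Union>n. {x n}) = range x" by blast
  then show "\<exists>F. (\<forall>n. finite (F n) \<and> F n \<subseteq> A n) \<and> \<Union>(\<Union>n. F n) = topspace X"
    using x by (intro exI[of _ "\<lambda>n. {x n}"]) simp
qed

lemma open_cover_Union_subset:
  assumes "open_cover X A" "F \<subseteq> A"
  shows "\<Union>F \<subseteq> topspace X"
  using assms unfolding open_cover_def by blast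

lemma open_cover_nonempty:
  assumes "open_cover X A" "topspace X \<noteq> {}"
  shows "A \<noteq> {}"
  using assms unfolding open_cover_def by blast

text \<open>The constant sequence \<open>A\<close> yields a countable subcover; it is nonempty
  because \<open>X\<close> is, so it can be enumerated, possibly with repetitions.\<close>

lemma menger_imp_countable_subcover:
  assumes "menger_space X" "topspace X \<noteq> {}" "open_cover X A"
  obtains e :: "nat \<Rightarrow> 'a set" where "range e \<subseteq> A" "\<Union>(range e) = topspace X"
proof -
  obtain F :: "nat \<Rightarrow> 'a set set" where F: "\<And>n. finite (F n) \<and> F n \<subseteq> A"
    and cov: "\<Union>(\<Union>n. F n) = topspace X"
    using menger_spaceE[OF assms(1), of "\<lambda>_. A"] assms(3) by metis
  have "countable (\<Union>n. F n)"
    using F by (auto intro: countable_finite)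
  moreover have "(\<Union>n. F n) \<noteq> {}"
    using cov assms(2) by force
  ultimately have "range (from_nat_into (\<Union>n. F n)) = (\<Union>n. F n)"
    by (simp add: range_from_nat_into)
  then show ?thesis using that[of "from_nat_into (\<Union>n. F n)"] F cov by auto
qed

text \<open>A finite part of an increasing cover lies in one member, so a selection amounts to a
  function \<open>h\<close>.\<close>

lemma menger_increasing:
  fixes V :: "nat \<Rightarrow> nat \<Rightarrow> 'a set"
  assumes "menger_space X"
    and op: "\<And>n k. openin X (V n k)"
    and mono: "\<And>n. mono (V n)"
    and cov: "\<And>n. (\<Union>k. V n k) = topspace X"
  obtains h where "\<And>x. x \<in> topspace X \<Longrightarrow> \<exists>n. x \<in> V n (h n)"
proof -
  have "\<forall>n. open_cover X (range (V n))" using op cov unfolding open_cover_def by auto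
  then obtain F where F: "\<And>n. finite (F n) \<and> F n \<subseteq> range (V n)" and
    FX: "\<Union>(\<Union>n. F n) = topspace X"
    using menger_spaceE[OF assms(1), of "\<lambda>n. range (V n)"] by metis
  have "\<exists>k. \<Union>(F n) \<subseteq> V n k" for n
  proof -
    obtain K where K: "finite K" "F n = V n ` K"
      using F finite_subset_image by metis
    \<comment> \<open>Inserting \<open>0\<close> provides a maximum also when \<open>F n\<close> is
      empty.\<close>
    then have "k \<le> Max (insert 0 K)" if "k \<in> K" for k using that by simp
    then have "V n k \<subseteq> V n (Max (insert 0 K))" if "k \<in> K" for k
      using that monoD[OF mono] by metis
    then have "\<Union>(F n) \<subseteq> V n (Max (insert 0 K))" unfolding K(2) by auto
    then show ?thesis by (rule exI)
  qed
  then obtain h where "\<And>n. \<Union>(F n) \<subseteq> V n (h n)" by metis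
  then have "\<exists>n. x \<in> V n (h n)" if "x \<in> topspace X" for x
    using that unfolding FX[symmetric] by blast
  then show ?thesis using that by metis
qed

text \<open>Each tail of the sequence has its own selection; one function dominates these countably
  many selections from their start on.\<close>

lemma menger_increasing_infinitely_often:
  fixes V :: "nat \<Rightarrow> nat \<Rightarrow> 'a set"
  assumes "menger_space X"
    and op: "\<And>n k. openin X (V n k)"
    and mono: "\<And>n. mono (V n)"
    and cov: "\<And>n. (\<Union>k. V n k) = topspace X"
  obtains g where "\<And>x N. x \<in> topspace X \<Longrightarrow> \<exists>n\<ge>N. x \<in> V n (g n)"
proof -
  have "\<exists>h. \<forall>x\<in>topspace X. \<exists>n. x \<in> V (N + n) (h n)" for N
    using menger_increasing[of X "\<lambda>n. V (N + n)"] assms by metis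
  then obtain h where h: "\<And>N x. x \<in> topspace X \<Longrightarrow> \<exists>n. x \<in> V (N + n) (h N n)" by metis
  define g where "g n = (\<Sum>N\<le>n. h N (n - N))" for n
  have "\<exists>n\<ge>N. x \<in> V n (g n)" if x: "x \<in> topspace X" for x N
  proof -
    obtain n where n: "x \<in> V (N + n) (h N n)" using h[OF x] by blast
    have "h N (N + n - N) \<le> g (N + n)"
      unfolding g_def by (rule member_le_sum) auto
    then have "x \<in> V (N + n) (g (N + n))"
      using n monoD[OF mono, of "h N n" "g (N + n)" "N + n"] by auto
    then show ?thesis using le_add1 by blast
  qed
  then show ?thesis using that by blast
qed

text \<open>If \<open>x\<close> enters \<open>Y m k\<close> from \<open>k = \<phi> m\<close> on, it is \<open>\<phi> (\<phi> m)\<close> rather than \<open>\<phi> m\<close>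
  that is dominated at infinitely many \<open>m\<close>: this makes the iterates \<open>a n\<close> of the dominating
  function satisfy \<open>\<phi> (a n) \<le> a (Suc n)\<close> or \<open>\<phi> (a (Suc n)) \<le> a (Suc (Suc n))\<close>.\<close>

lemma menger_fast_growing_sequence:
  fixes Y :: "nat \<Rightarrow> nat \<Rightarrow> 'a set"
  assumes "menger_space X"
    and op: "\<And>m k. openin X (Y m k)"
    and mono: "\<And>m. mono (Y m)"
    and anti: "\<And>k. antimono (\<lambda>m. Y m k)"
    and cov: "\<And>m. (\<Union>k. Y m k) = topspace X"
  obtains a where "strict_mono a" "\<And>x N. x \<in> topspace X \<Longrightarrow> \<exists>n\<ge>N. x \<in> Y (a n) (a (Suc n))"
proof -
  \<comment> \<open>Membership of \<open>x\<close> in \<open>V m k\<close> records two steps: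
    \<open>x\<close> lies in \<open>Y m j\<close> for some \<open>j \<le> k\<close>, and then in
    \<open>Y j k\<close>.\<close>
  define V where "V m k = (\<Union>j\<le>k. Y m j \<inter> Y j k)" for m k
  have Vop: "openin X (V m k)" for m k
    unfolding V_def using op by auto
  have Vmono: "mono (V m)" for m
  proof (rule monoI)
    fix k l :: nat assume kl: "k \<le> l"
    then have "Y j k \<subseteq> Y j l" for j using mono monoD by blast
    then show "V m k \<subseteq> V m l" unfolding V_def using kl by fastforce
  qed
  have Vcov: "(\<Union>k. V m k) = topspace X" for m
  proof (intro equalityI subsetI)
    fix x assume "x \<in> (\<Union>k. V m k)"
    then show "x \<in> topspace X" using Vop openin_subset by blast
  next
    fix x assume "x \<in> topspace X"
    then obtain j k where jk: "x \<in> Y m j" "x \<in> Y j k" using cov by blast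
    then have "x \<in> Y j (max j k)" using monoD[OF mono, of k "max j k" j] by auto
    then have "x \<in> V m (max j k)" using jk unfolding V_def by auto
    then show "x \<in> (\<Union>k. V m k)" by blast
  qed
  obtain g0 where g0: "\<And>x N. x \<in> topspace X \<Longrightarrow> \<exists>n\<ge>N. x \<in> V n (g0 n)"
    using menger_increasing_infinitely_often[OF assms(1), of V, OF Vop Vmono Vcov] by metis
  \<comment> \<open>\<open>Suc n\<close> makes the iterates strictly increasing; the sum gives
    monotonicity and dominates \<open>g0\<close>.\<close>
  define g where "g n = Suc n + (\<Sum>i\<le>n. g0 i)" for n
  have g_ge: "g0 n \<le> g n" for n
    using member_le_sum[of n "{..n}" g0] unfolding g_def by simp
  have g_mono: "g k \<le> g l" if "k \<le> l" for k l
    unfolding g_def using that by (intro add_mono sum_mono2) auto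
  define a where "a n = (g ^^ n) 0" for n
  have a_Suc: "a (Suc n) = g (a n)" for n unfolding a_def by simp
  have sm: "strict_mono a" unfolding strict_mono_Suc_iff a_Suc g_def by simp
  have "\<exists>n\<ge>N. x \<in> Y (a n) (a (Suc n))" if x: "x \<in> topspace X" for x N
  proof -
    obtain m where m: "m \<ge> a N" "x \<in> V m (g0 m)" using g0[OF x] by metis
    have "x \<in> V m (g m)" using m(2) monoD[OF Vmono g_ge] by auto
    then obtain j where j: "x \<in> Y m j" "x \<in> Y j (g m)" unfolding V_def by auto
    have "m < a (Suc m)" using strict_mono_imp_increasing[OF sm, of "Suc m"] by simp
    \<comment> \<open>This is the index with \<open>a n \<le> m < a (Suc n)\<close>; it exists
      because \<open>i \<le> a i\<close>.\<close>
    define n where "n = (GREATEST n. a n \<le> m)"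
    have bound: "i \<le> m" if "a i \<le> m" for i
      using strict_mono_imp_increasing[OF sm, of i] that by simp
    have n: "a n \<le> m" "N \<le> n"
      unfolding n_def using m(1) bound
      by (metis (mono_tags, lifting) GreatestI_nat, metis (mono_tags, lifting) Greatest_le_nat)
    have nS: "m < a (Suc n)"
      using Greatest_le_nat[of "\<lambda>n. a n \<le> m" "Suc n" m] bound unfolding n_def
      by (metis not_less_eq_eq not_less order_refl)
    \<comment> \<open>Either the first step ends within \<open>a (Suc n)\<close>, or
      \<open>j\<close> exceeds this bound and the second step carries over to
      \<open>Y (a (Suc n))\<close>, as \<open>g m \<le> g (a (Suc n))\<close>.\<close>
    show ?thesis
    proof (cases "j \<le> a (Suc n)")
      case True
      have "x \<in> Y (a n) j" using j(1) antimonoD[OF anti n(1)] by blast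
      then have "x \<in> Y (a n) (a (Suc n))" using monoD[OF mono True] by blast
      then show ?thesis using n by blast
    next
      case False
      then have "x \<in> Y (a (Suc n)) (g m)" using j(2) antimonoD[OF anti, of "a (Suc n)" j "g m"] by auto
      moreover have "g m \<le> a (Suc (Suc n))"
        unfolding a_Suc[of "Suc n"] using g_mono nS by simp
      ultimately have "x \<in> Y (a (Suc n)) (a (Suc (Suc n)))" using monoD[OF mono] by blast
      then show ?thesis using n by (meson le_SucI)
    qed
  qed
  then show ?thesis using that sm by metis
qed

section \<open>Trees of covers in Menger spaces\<close>

text \<open>Finite sets of positions that increase to all finite sequences, governed by a single
  parameter.\<close>

definition bounded_lists :: "nat \<Rightarrow> nat list set" where
  "bounded_lists m = {s. set s \<subseteq> {..m} \<and> length s \<le> m}"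

lemma finite_bounded_lists: "finite (bounded_lists m)"
  unfolding bounded_lists_def by (intro finite_lists_length_le) simp

lemma bounded_lists_mono: "m \<le> n \<Longrightarrow> bounded_lists m \<subseteq> bounded_lists n"
  unfolding bounded_lists_def by auto

lemma Nil_in_bounded_lists: "[] \<in> bounded_lists m"
  unfolding bounded_lists_def by simp

lemma menger_tree:
  fixes U :: "nat list \<Rightarrow> nat \<Rightarrow> 'a set"
  assumes "menger_space X"
    and op: "\<And>s k. openin X (U s k)"
    and cov: "\<And>s. (\<Union>k. U s k) = topspace X"
  obtains a where "strict_mono a"
    "\<And>x N. x \<in> topspace X \<Longrightarrow> \<exists>n\<ge>N. \<forall>s\<in>bounded_lists (a n). \<exists>k<a (Suc n). x \<in> U s k"
proof -
  \<comment> \<open>These points are caught by the first \<open>k\<close> sets at all bounded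
    positions at once. The position \<open>[]\<close> keeps the finite intersection nonempty, hence
    open and inside the space.\<close>
  define Y where "Y m k = (\<Inter>s\<in>bounded_lists m. \<Union>i<k. U s i)" for m k
  have "openin X (Y m k)" for m k
    unfolding Y_def using op finite_bounded_lists Nil_in_bounded_lists
    by (intro openin_Inter) (blast | simp)+
  moreover have "mono (Y m)" for m
    unfolding Y_def by (intro monoI INF_mono' UN_mono) auto
  moreover have "antimono (\<lambda>m. Y m k)" for k
    unfolding Y_def by (intro antimonoI INF_superset_mono bounded_lists_mono) auto
  moreover have "(\<Union>k. Y m k) = topspace X" for m
  proof (intro equalityI subsetI)
    fix x assume "x \<in> (\<Union>k. Y m k)"
    then obtain k where "x \<in> (\<Union>i<k. U [] i)"
      using Nil_in_bounded_lists unfolding Y_def by blast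
    then show "x \<in> topspace X" using op openin_subset by blast
  next
    fix x assume x: "x \<in> topspace X"
    then have "\<exists>k. x \<in> U s k" for s using cov by blast
    then obtain i where i: "\<And>s. x \<in> U s (i s)" by metis
    \<comment> \<open>The sum bounds all these indices at once; \<open>Suc\<close> accounts for the
      strict \<open>i < k\<close> in \<open>Y\<close>.\<close>
    have "i s < Suc (\<Sum>s\<in>bounded_lists m. i s)" if "s \<in> bounded_lists m" for s
      using member_le_sum[of s "bounded_lists m" i] that finite_bounded_lists by (simp add: less_Suc_eq_le)
    then have "x \<in> Y m (Suc (\<Sum>s\<in>bounded_lists m. i s))"
      unfolding Y_def using i by blast
    then show "x \<in> (\<Union>k. Y m k)" by blast
  qed
  ultimately obtain a where a: "strict_mono a"
    "\<And>x N. x \<in> topspace X \<Longrightarrow> \<exists>n\<ge>N. x \<in> Y (a n) (a (Suc n))"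
    using menger_fast_growing_sequence[OF assms(1), of Y] by metis
  show ?thesis
  proof (rule that[OF a(1)])
    fix x N assume "x \<in> topspace X"
    then obtain n where "n \<ge> N" "x \<in> Y (a n) (a (Suc n))" using a(2) by blast
    then show "\<exists>n\<ge>N. \<forall>s\<in>bounded_lists (a n). \<exists>k<a (Suc n). x \<in> U s k"
      unfolding Y_def by blast
  qed
qed

text \<open>The length \<open>n\<close> is at most \<open>a n\<close>, and the entries are at most
  \<open>a (Suc i) \<le> a n\<close>.\<close>

lemma map_upt_in_bounded_lists:
  assumes "strict_mono a" "\<And>i. f i \<le> a (Suc i)"
  shows "map f [0..<n] \<in> bounded_lists (a n)"
proof -
  have "f i \<le> a n" if "i < n" for i
    using assms(2)[of i] strict_mono_less_eq[OF assms(1), of "Suc i" n] that by simp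
  then show ?thesis
    using strict_mono_imp_increasing[OF assms(1), of n] unfolding bounded_lists_def by auto
qed

section \<open>Trees of covers in Rothberger spaces\<close>

text \<open>Greedy choice: the earlier choices occupy at most \<open>j\<close> elements, and
  \<open>I j\<close> has one more.\<close>

lemma injective_choice:
  fixes I :: "nat \<Rightarrow> 'b set"
  assumes "\<And>j. finite (I j)" "\<And>j. card (I j) = Suc j"
  obtains c where "\<And>j. c j \<in> I j" "inj c"
proof -
  have "\<exists>c. \<forall>j. c j \<in> I j \<and> c j \<notin> c ` {..<j}"
  proof (rule dependent_wf_choice[OF wf_less, where P = "\<lambda>c j r. r \<in> I j \<and> r \<notin> c ` {..<j}"])
    fix r :: 'b and f g :: "nat \<Rightarrow> 'b" and j
    assume "\<And>i. (i, j) \<in> {(x, y). x < y} \<Longrightarrow> f i = g i"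
    then have "f ` {..<j} = g ` {..<j}" by auto
    then show "(r \<in> I j \<and> r \<notin> f ` {..<j}) = (r \<in> I j \<and> r \<notin> g ` {..<j})" by simp
  next
    fix f :: "nat \<Rightarrow> 'b" and j
    have "card (f ` {..<j}) \<le> j" using card_image_le[of "{..<j}" f] by simp
    then have "\<not> I j \<subseteq> f ` {..<j}"
      using card_mono[of "f ` {..<j}" "I j"] assms(2)[of j] by auto
    then show "\<exists>r. r \<in> I j \<and> r \<notin> f ` {..<j}" by blast
  qed
  then obtain c where c: "\<And>j. c j \<in> I j" "\<And>j i. i < j \<Longrightarrow> c j \<noteq> c i" by auto
  then have "inj c" by (metis injI linorder_neqE_nat)
  then show ?thesis using c that by metis
qed

text \<open>A Rothberger selection from the intersections of \<open>j + 1\<close> members of distinct \<open>\<W> n\<close> leaves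
  in step \<open>j\<close> at least one \<open>n\<close> that was not used before.\<close>

lemma rothberger_infinitely_often:
  fixes \<W> :: "nat \<Rightarrow> 'a set set"
  assumes "rothberger_space X"
    and op: "\<And>n W. W \<in> \<W> n \<Longrightarrow> openin X W"
    and ne: "\<And>n. \<W> n \<noteq> {}"
    and inf: "\<And>x N. x \<in> topspace X \<Longrightarrow> \<exists>n\<ge>N. x \<in> \<Union>(\<W> n)"
  obtains w where "\<And>n. w n \<in> \<W> n" "(\<Union>n. w n) = topspace X"
proof -
  define B where "B j = {\<Inter>(v ` I) |v I. finite I \<and> card I = Suc j \<and> (\<forall>n. v n \<in> \<W> n)}" for j
  have "openin X b" if b: "b \<in> B j" for b j
  proof -
    obtain v I where "b = \<Inter>(v ` I)" "finite I" "card I = Suc j" "\<forall>n. v n \<in> \<W> n"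
      using b unfolding B_def by auto
    moreover have "I \<noteq> {}" using \<open>card I = Suc j\<close> by auto
    ultimately show ?thesis using op by (metis (no_types, lifting) empty_is_image finite_imageI imageE openin_Inter)
  qed
  moreover have "x \<in> \<Union>(B j)" if x: "x \<in> topspace X" for x j
  proof -
    have "infinite {n. x \<in> \<Union>(\<W> n)}"
      unfolding infinite_nat_iff_unbounded_le using inf[OF x] by simp
    then obtain I where I: "I \<subseteq> {n. x \<in> \<Union>(\<W> n)}" "finite I" "card I = Suc j"
      using infinite_arbitrarily_large by metis
    have "\<exists>W. W \<in> \<W> n \<and> (n \<in> I \<longrightarrow> x \<in> W)" for n using I(1) ne[of n] by auto
    then obtain v where "\<And>n. v n \<in> \<W> n \<and> (n \<in> I \<longrightarrow> x \<in> v n)" by metis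
    then have "\<Inter>(v ` I) \<in> B j" "x \<in> \<Inter>(v ` I)" using I(2,3) unfolding B_def by auto
    then show ?thesis by blast
  qed
  ultimately have "open_cover X (B j)" for j
    unfolding open_cover_def by (meson Sup_least equalityI openin_subset subsetI)
  then obtain b where b: "\<And>j. b j \<in> B j" "\<Union>(range b) = topspace X"
    using rothberger_spaceE[OF assms(1)] by metis
  then have "\<exists>v I. b j = \<Inter>(v ` I) \<and> finite I \<and> card I = Suc j \<and> (\<forall>n. v n \<in> \<W> n)" for j
    unfolding B_def by (simp add: set_eq_iff)
  then obtain v I where vI: "\<And>j. b j = \<Inter>(v j ` I j)" "\<And>j. finite (I j)" "\<And>j. card (I j) = Suc j"
    "\<And>j n. v j n \<in> \<W> n" by metis
  obtain c where c: "\<And>j. c j \<in> I j" "inj c" using injective_choice vI(2,3) by metis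
  \<comment> \<open>At \<open>n = c j\<close> the choice \<open>v j\<close> is used, so
    \<open>w (c j)\<close> contains \<open>b j\<close>; off the range of \<open>c\<close> the value
    is some member of \<open>\<W> n\<close>.\<close>
  define w where "w n = v (inv c n) n" for n
  have w: "w n \<in> \<W> n" for n unfolding w_def using vI(4) by blast
  have "b j \<subseteq> w (c j)" for j unfolding w_def using vI(1) c by auto
  then have "topspace X \<subseteq> (\<Union>n. w n)" unfolding b(2)[symmetric] by blast
  moreover have "(\<Union>n. w n) \<subseteq> topspace X"
    using openin_subset[OF op[OF w]] by (rule UN_least)
  ultimately show ?thesis using that[of w] w by simp
qed

text \<open>Replies are selected for all positions bounded by \<open>a n\<close> before the branch
  is known; the branch following them visits only such positions.\<close>

lemma rothberger_tree:
  fixes U :: "nat list \<Rightarrow> nat \<Rightarrow> 'a set"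
  assumes "rothberger_space X"
    and op: "\<And>s k. openin X (U s k)"
    and cov: "\<And>s. (\<Union>k. U s k) = topspace X"
  obtains f where "(\<Union>n. U (map f [0..<n]) (f n)) = topspace X"
proof -
  obtain a where a: "strict_mono a"
    "\<And>x N. x \<in> topspace X \<Longrightarrow> \<exists>n\<ge>N. \<forall>s\<in>bounded_lists (a n). \<exists>k<a (Suc n). x \<in> U s k"
    using menger_tree[OF rothberger_imp_menger[OF assms(1)], of U, OF op cov] by metis
  have a_pos: "0 < a (Suc n)" for n
    using strict_mono_imp_increasing[OF a(1), of "Suc n"] by simp
  \<comment> \<open>A member packs one reply for each bounded position and is contained in each of
    the sets it replies with.\<close>
  define \<W> where
    "\<W> n = {\<Inter>s\<in>bounded_lists (a n). U s (k s) |k. \<forall>s. k s < a (Suc n)}" for n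
  have "\<W> n \<noteq> {}" for n
    unfolding \<W>_def using a_pos by (auto intro!: exI[of _ "\<lambda>_. 0"])
  moreover have "openin X W" if "W \<in> \<W> n" for W n
    using that op finite_bounded_lists Nil_in_bounded_lists[of "a n"]
    unfolding \<W>_def by (auto intro!: openin_Inter)
  moreover have "\<exists>n\<ge>N. x \<in> \<Union>(\<W> n)" if x: "x \<in> topspace X" for x N
  proof -
    obtain n where n: "n \<ge> N" "\<forall>s\<in>bounded_lists (a n). \<exists>k<a (Suc n). x \<in> U s k"
      using a(2)[OF x] by metis
    then have "\<exists>k<a (Suc n). s \<in> bounded_lists (a n) \<longrightarrow> x \<in> U s k" for s
      using a_pos by blast
    then obtain k where "\<And>s. k s < a (Suc n) \<and> (s \<in> bounded_lists (a n) \<longrightarrow> x \<in> U s (k s))"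
      by metis
    then have "(\<Inter>s\<in>bounded_lists (a n). U s (k s)) \<in> \<W> n"
      "x \<in> (\<Inter>s\<in>bounded_lists (a n). U s (k s))"
      unfolding \<W>_def by auto
    then show ?thesis using n(1) by blast
  qed
  ultimately obtain w where w: "\<And>n. w n \<in> \<W> n" "(\<Union>n. w n) = topspace X"
    using rothberger_infinitely_often[OF assms(1), of \<W>] by metis
  have "\<forall>n. \<exists>k. w n = (\<Inter>s\<in>bounded_lists (a n). U s (k s)) \<and> (\<forall>s. k s < a (Suc n))"
    using w(1) unfolding \<W>_def by simp
  then obtain k where k: "\<And>n. w n = (\<Inter>s\<in>bounded_lists (a n). U s (k n s))"
    "\<And>n s. k n s < a (Suc n)" by metis
  \<comment> \<open>\<open>p n\<close> is the position reached after \<open>n\<close> rounds when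
    every reply is read off from \<open>k\<close>.\<close>
  define p where "p = rec_nat [] (\<lambda>n s. s @ [k n s])"
  define f where "f n = k n (p n)" for n
  have p: "p n = map f [0..<n]" for n
    by (induction n) (auto simp: p_def f_def)
  have "map f [0..<n] \<in> bounded_lists (a n)" for n
    using map_upt_in_bounded_lists[OF a(1)] k(2) unfolding f_def by (meson less_imp_le)
  then have "w n \<subseteq> U (map f [0..<n]) (f n)" for n
    unfolding k(1) f_def[of n] p by blast
  then have "topspace X \<subseteq> (\<Union>n. U (map f [0..<n]) (f n))"
    unfolding w(2)[symmetric] by (rule SUP_mono')
  moreover have "(\<Union>n. U (map f [0..<n]) (f n)) \<subseteq> topspace X"
    using openin_subset[OF op] by (rule UN_least)
  ultimately show ?thesis using that[of f] by simp
qed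

section \<open>The selection games\<close>

text \<open>A sequence of nontrivial covers is a predetermined strategy, and a play defeating it is
  a selection. If some cover contains the whole space, selecting the space there suffices.\<close>

lemma not_One_wins_pre_G1_imp_rothberger:
  assumes "\<not> One_wins_pre (G1 (nontrivial_open_covers X) (nontrivial_open_covers X))"
    and ne: "topspace X \<noteq> {}"
  shows "rothberger_space X"
  unfolding rothberger_space_def
proof (intro allI impI)
  fix A :: "nat \<Rightarrow> 'a set set" assume A: "\<forall>n. open_cover X (A n)"
  show "\<exists>x. (\<forall>n. x n \<in> A n) \<and> \<Union>(range x) = topspace X"
  proof (cases "\<exists>m. topspace X \<in> A m")
    case True
    then obtain m where m: "topspace X \<in> A m" by blast
    obtain y where y: "\<And>n. y n \<in> A n" using A open_cover_nonempty[OF _ ne] by (meson ex_in_conv)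
    then have "y n \<subseteq> topspace X" for n
      using A open_cover_Union_subset[of X "A n" "{y n}"] by simp
    then show ?thesis
      using y m by (intro exI[of _ "y(m := topspace X)"]) auto
  next
    case False
    define \<sigma> where "\<sigma> s = A (length s)" for s :: "'a set list"
    have "strategy_One (G1 (nontrivial_open_covers X) (nontrivial_open_covers X)) \<sigma>"
      "predetermined \<sigma>"
      using A False
      by (auto simp: strategy_One_def predetermined_def G1_def \<sigma>_def nontrivial_open_covers_def)
    then have "\<not> winning_One (G1 (nontrivial_open_covers X) (nontrivial_open_covers X)) \<sigma>"
      using assms(1) unfolding One_wins_pre_def by blast
    then show ?thesis
      unfolding winning_One_def G1_def \<sigma>_def nontrivial_open_covers_def open_cover_def by auto
  qed
qed

lemma not_One_wins_pre_Gfin_imp_menger: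
  assumes "\<not> One_wins_pre (Gfin (nontrivial_open_covers X) (nontrivial_open_covers X))"
  shows "menger_space X"
  unfolding menger_space_def
proof (intro allI impI)
  fix A :: "nat \<Rightarrow> 'a set set" assume A: "\<forall>n. open_cover X (A n)"
  show "\<exists>F. (\<forall>n. finite (F n) \<and> F n \<subseteq> A n) \<and> \<Union>(\<Union>n. F n) = topspace X"
  proof (cases "\<exists>m. topspace X \<in> A m")
    case True
    then obtain m where m: "topspace X \<in> A m" by blast
    then show ?thesis
      by (intro exI[of _ "(\<lambda>_. {})(m := {topspace X})"]) (auto split: if_splits)
  next
    case False
    define \<sigma> where "\<sigma> s = A (length s)" for s :: "'a set set list"
    have "strategy_One (Gfin (nontrivial_open_covers X) (nontrivial_open_covers X)) \<sigma>"
      "predetermined \<sigma>"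
      using A False
      by (auto simp: strategy_One_def predetermined_def Gfin_def \<sigma>_def nontrivial_open_covers_def)
    then have "\<not> winning_One (Gfin (nontrivial_open_covers X) (nontrivial_open_covers X)) \<sigma>"
      using assms unfolding One_wins_pre_def by blast
    then show ?thesis
      unfolding winning_One_def Gfin_def \<sigma>_def nontrivial_open_covers_def open_cover_def by auto
  qed
qed

text \<open>The moves of Two when she encodes by a number \<open>k\<close> the move \<open>r s k\<close> at the position \<open>s\<close>.\<close>

definition decode_moves :: "('t list \<Rightarrow> nat \<Rightarrow> 't) \<Rightarrow> nat list \<Rightarrow> 't list" where
  "decode_moves r s = foldl (\<lambda>p k. p @ [r p k]) [] s"

text \<open>Along the branch \<open>f\<close>, the history that One sees is the decoded position, so
  his next move is the cover at that node.\<close>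

lemma map_decode_moves:
  "map (\<lambda>n. r (decode_moves r (map f [0..<n])) (f n)) [0..<n] = decode_moves r (map f [0..<n])"
  by (induction n) (simp_all add: decode_moves_def)

lemma nontrivial_open_cover_enumeration:
  assumes "menger_space X" "topspace X \<noteq> {}"
  obtains e :: "'a set set \<Rightarrow> nat \<Rightarrow> 'a set"
  where "\<And>A. A \<in> nontrivial_open_covers X \<Longrightarrow> range (e A) \<subseteq> A \<and> (\<Union>k. e A k) = topspace X"
proof -
  have "\<exists>e :: nat \<Rightarrow> 'a set. range e \<subseteq> A \<and> (\<Union>k. e k) = topspace X"
    if "A \<in> nontrivial_open_covers X" for A
  proof -
    have "open_cover X A" using that unfolding nontrivial_open_covers_def by simp
    from menger_imp_countable_subcover[OF assms this] show ?thesis by metis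
  qed
  then show ?thesis using that by metis
qed

lemma nontrivial_open_covers_openin:
  assumes "A \<in> nontrivial_open_covers X" "U \<in> A"
  shows "openin X U"
  using assms unfolding nontrivial_open_covers_def open_cover_def by simp

text \<open>Members of nontrivial covers are open and differ from the whole space, so a selection of
  Two only has to cover.\<close>

lemma nontrivial_open_covers_subset_Union:
  assumes "\<F> \<subseteq> \<Union>(nontrivial_open_covers X)" "\<Union>\<F> = topspace X"
  shows "\<F> \<in> nontrivial_open_covers X"
  using assms unfolding nontrivial_open_covers_def open_cover_def by blast

section \<open>Defeating an arbitrary strategy of One\<close>

text \<open>A reply is coded by its index in the enumeration; a branch whose sets cover
  \<open>X\<close> is a play defeating \<open>\<sigma>\<close>.\<close>

theorem rothberger_imp_not_One_wins_G1:
  assumes "rothberger_space X" "topspace X \<noteq> {}"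
  shows "\<not> One_wins (G1 (nontrivial_open_covers X) (nontrivial_open_covers X))"
proof
  let ?O = "nontrivial_open_covers X"
  assume "One_wins (G1 ?O ?O)"
  then obtain \<sigma> where \<sigma>: "\<And>s. \<sigma> s \<in> ?O"
    and win: "\<And>x. (\<And>n. x n \<in> \<sigma> (map x [0..<n])) \<Longrightarrow> range x \<notin> ?O"
    unfolding One_wins_def strategy_One_def winning_One_def G1_def by auto
  obtain e :: "'a set set \<Rightarrow> nat \<Rightarrow> 'a set" where e: "\<And>A. A \<in> ?O \<Longrightarrow> range (e A) \<subseteq> A \<and> (\<Union>k. e A k) = topspace X"
    by (rule nontrivial_open_cover_enumeration[OF rothberger_imp_menger[OF assms(1)] assms(2)]) blast
  define r where "r p = e (\<sigma> p)" for p
  define U where "U s = r (decode_moves r s)" for s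
  have r: "r p k \<in> \<sigma> p" "(\<Union>k. r p k) = topspace X" for p k
    using e[OF \<sigma>] unfolding r_def by auto
  then have op: "openin X (U s k)" for s k
    unfolding U_def by (intro nontrivial_open_covers_openin[OF \<sigma>])
  have cov: "(\<Union>k. U s k) = topspace X" for s
    unfolding U_def by (rule r(2))
  obtain f where f: "(\<Union>n. U (map f [0..<n]) (f n)) = topspace X"
    by (rule rothberger_tree[OF assms(1), of U, OF op cov])
  define x where "x n = U (map f [0..<n]) (f n)" for n
  have "map x [0..<n] = decode_moves r (map f [0..<n])" for n
    unfolding x_def U_def by (rule map_decode_moves)
  then have "x n \<in> \<sigma> (map x [0..<n])" for n
    using r(1) unfolding x_def U_def by simp
  moreover from this have "range x \<in> ?O"
    using \<sigma> f by (intro nontrivial_open_covers_subset_Union) (auto simp: x_def[symmetric])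
  ultimately show False using win by simp
qed

theorem menger_imp_not_One_wins_Gfin:
  assumes "menger_space X" "topspace X \<noteq> {}"
  shows "\<not> One_wins (Gfin (nontrivial_open_covers X) (nontrivial_open_covers X))"
proof
  let ?O = "nontrivial_open_covers X"
  assume "One_wins (Gfin ?O ?O)"
  then obtain \<sigma> where \<sigma>: "\<And>s. \<sigma> s \<in> ?O"
    and win: "\<And>x. (\<And>n. finite (x n) \<and> x n \<subseteq> \<sigma> (map x [0..<n])) \<Longrightarrow> (\<Union>n. x n) \<notin> ?O"
    unfolding One_wins_def strategy_One_def winning_One_def Gfin_def by auto
  obtain e :: "'a set set \<Rightarrow> nat \<Rightarrow> 'a set" where e: "\<And>A. A \<in> ?O \<Longrightarrow> range (e A) \<subseteq> A \<and> (\<Union>k. e A k) = topspace X"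
    by (rule nontrivial_open_cover_enumeration[OF assms]) blast
  \<comment> \<open>Here the code is the number of enumerated sets that Two plays.\<close>
  define r where "r p k = e (\<sigma> p) ` {..<k}" for p k
  define U where "U s = e (\<sigma> (decode_moves r s))" for s
  have eU: "U s k \<in> \<sigma> (decode_moves r s)" "(\<Union>k. U s k) = topspace X" for s k
    using e[OF \<sigma>] unfolding U_def by auto
  then have op: "openin X (U s k)" for s k
    by (intro nontrivial_open_covers_openin[OF \<sigma>])
  obtain a where a: "strict_mono a"
    "\<And>x N. x \<in> topspace X \<Longrightarrow> \<exists>n\<ge>N. \<forall>s\<in>bounded_lists (a n). \<exists>k<a (Suc n). x \<in> U s k"
    using menger_tree[OF assms(1), of U, OF op eU(2)] by metis
  \<comment> \<open>With these codes every position is bounded by \<open>a n\<close>, so each point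
    is caught in some round by the sets played there.\<close>
  define f where "f n = a (Suc n)" for n
  have bl: "map f [0..<n] \<in> bounded_lists (a n)" for n
    by (rule map_upt_in_bounded_lists[OF a(1)]) (simp add: f_def)
  define x where "x n = r (decode_moves r (map f [0..<n])) (f n)" for n
  have x_eq: "x n = U (map f [0..<n]) ` {..<f n}" for n
    unfolding x_def U_def r_def by simp
  have "map x [0..<n] = decode_moves r (map f [0..<n])" for n
    unfolding x_def by (rule map_decode_moves)
  then have x: "finite (x n) \<and> x n \<subseteq> \<sigma> (map x [0..<n])" for n
    using eU(1) unfolding x_eq by auto
  have "\<exists>n. y \<in> \<Union>(x n)" if y: "y \<in> topspace X" for y
  proof -
    obtain n where "\<forall>s\<in>bounded_lists (a n). \<exists>k<a (Suc n). y \<in> U s k"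
      using a(2)[OF y] by metis
    then obtain k where "k < f n" "y \<in> U (map f [0..<n]) k" using bl unfolding f_def by metis
    then show ?thesis unfolding x_eq by auto
  qed
  then have "topspace X \<subseteq> \<Union>(\<Union>n. x n)" by blast
  moreover have "\<Union>(\<Union>n. x n) \<subseteq> topspace X" using eU(2) unfolding x_eq by auto
  moreover have "x n \<subseteq> \<Union>?O" for n
    using x[of n] \<sigma>[of "map x [0..<n]"] by auto
  ultimately have "(\<Union>n. x n) \<in> ?O"
    by (intro nontrivial_open_covers_subset_Union UN_least equalityI)
  then show False using win[OF x] by simp
qed

lemma One_wins_pre_imp_One_wins: "One_wins_pre \<G> \<Longrightarrow> One_wins \<G>"
  unfolding One_wins_pre_def One_wins_def by blast

text \<open>Against \<open>{topspace X}\<close> Two can select only the whole space or, with finite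
  sets, nothing; neither yields a nontrivial cover.\<close>

lemma One_wins_pre_trivial_cover:
  assumes "{topspace X} \<in> \<C>" "topspace X \<noteq> {}"
  shows "One_wins_pre (G1 \<C> (nontrivial_open_covers X))"
    "One_wins_pre (Gfin \<C> (nontrivial_open_covers X))"
proof -
  have "range x \<notin> nontrivial_open_covers X" if "\<forall>n. x n = topspace X" for x :: "nat \<Rightarrow> 'a set"
    using that unfolding nontrivial_open_covers_def by (metis mem_Collect_eq rangeI)
  then show "One_wins_pre (G1 \<C> (nontrivial_open_covers X))"
    unfolding One_wins_pre_def strategy_One_def predetermined_def winning_One_def G1_def
    using assms by (intro exI[of _ "\<lambda>_. {topspace X}"]) auto
  have "\<F> \<notin> nontrivial_open_covers X" if "\<F> \<subseteq> {topspace X}" for \<F>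
    using that assms(2) unfolding nontrivial_open_covers_def open_cover_def by blast
  then show "One_wins_pre (Gfin \<C> (nontrivial_open_covers X))"
    unfolding One_wins_pre_def strategy_One_def predetermined_def winning_One_def Gfin_def
    using assms by (intro exI[of _ "\<lambda>_. {topspace X}"]) (auto simp: UN_subset_iff)
qed

theorem corollary4p11:
  fixes X :: "'a topology" and \<UU> :: "('a \<times> 'a) set set"
  assumes "infinite (topspace X)"
    and "paracompact_space X"
    and "Hausdorff_space X"
    and "universal_uniformity X \<UU>"
  shows "\<forall>\<C> \<in> {uniform_open_covers X \<UU>, nontrivial_uniform_open_covers X \<UU>}.
      (One_wins_pre (G1 \<C> (nontrivial_open_covers X)) \<longleftrightarrow>
         One_wins (G1 \<C> (nontrivial_open_covers X))) \<and>
      (One_wins_pre (Gfin \<C> (nontrivial_open_covers X)) \<longleftrightarrow>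
         One_wins (Gfin \<C> (nontrivial_open_covers X)))"
proof -
  have ne: "topspace X \<noteq> {}" using assms(1) by auto
  have "{topspace X} \<in> uniform_open_covers X \<UU>"
    unfolding uniform_open_covers_universal[OF assms(2-4)] open_cover_def by simp
  note trivial = One_wins_pre_trivial_cover[OF this ne]
  \<comment> \<open>If the trivial cover is available, One wins both games with a predetermined
    strategy. Otherwise his moves are all nontrivial open covers, and the contrapositive passes
    through the Rothberger or Menger property.\<close>
  show ?thesis
    unfolding nontrivial_uniform_open_covers_universal[OF assms(2-4)]
    using trivial One_wins_pre_imp_One_wins ne
      not_One_wins_pre_G1_imp_rothberger rothberger_imp_not_One_wins_G1
      not_One_wins_pre_Gfin_imp_menger menger_imp_not_One_wins_Gfin
    by (metis insert_iff empty_iff)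
qed

end
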